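(* Let $H$ be a non-coassociative bimonoid in $\mathsf{C}$, and let $\gamma_R=(H\otimes\mu_H)\circ(\delta_H\otimes H)$ and $\gamma_L=(\mu_H\otimes H)\circ(H\otimes\delta_H)$, both morphisms $H\otimes H\to H\otimes H$. The following assertions hold: (i) There exists a right codivision $r_H$ for $H$ if and only if $\gamma_R$ is an isomorphism. Consequently, $r_H$ is uniquely determined as $r_H=\gamma_R^{-1}\circ(H\otimes\eta_H)$. (ii) There exists a left codivision $l_H$ for $H$ if and only if $\gamma_L$ is an isomorphism. Hence, $l_H$ is uniquely determined as $l_H=\gamma_L^{-1}\circ(\eta_H\otimes H)$.
   Context: $\mathsf{C}$ is a strict symmetric monoidal category with tensor product $\otimes$, unit object $K$ and symmetry $c$. For an object $P$ and a morphism $f$, write $P\otimes f$ for $\mathrm{id}_P\otimes f$ and $f\otimes P$ for $f\otimes \mathrm{id}_P$. A counital comagma is a triple $(D,\varepsilon_D,\delta_D)$ with $\varepsilon_D:D\to K$, $\delta_D:D\to D\otimes D$ such that $(\varepsilon_D\otimes D)\circ\delta_D=\mathrm{id}_D=(D\otimes\varepsilon_D)\circ\delta_D$ (no coassociativity required). A non-coassociative bimonoid is an object $H$ with a monoid structure $(H,\eta_H,\mu_H)$ (unital and associative) and a counital comagma structure $(H,\varepsilon_H,\delta_H)$ such that $\varepsilon_H\circ\eta_H=\mathrm{id}_K$, $\delta_H\circ\eta_H=\eta_H\otimes\eta_H$, $\varepsilon_H\circ\mu_H=\varepsilon_H\otimes\varepsilon_H$, and $\delta_H\circ\mu_H=(\mu_H\otimes\mu_H)\circ(H\otimes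 c_{H,H}\otimes H)\circ(\delta_H\otimes\delta_H)$. A right codivision of $H$ is a morphism $r_H:H\to H\otimes H$ such that $\gamma_R\circ r_H=H\otimes\eta_H=(H\otimes\mu_H)\circ(r_H\otimes H)\circ\delta_H$. A left codivision of $H$ is a morphism $l_H:H\to H\otimes H$ such that $\gamma_L\circ l_H=\eta_H\otimes H=(\mu_H\otimes H)\circ(H\otimes l_H)\circ\delta_H$. *)

theory Defs
  imports Main
begin

text \<open>A category with explicit carriers, together with the data of a tensor product, a unit
  object and a symmetry. Strictness is expressed by genuine equalities of objects and of
  arrows, so no associator or unitor appears in the data. Objects are tensored with \<open>\<odot>\<close>,
  arrows with \<open>\<otimes>\<close>, and \<open>\<one> A\<close> is the identity of the object \<open>A\<close>; thus
  the usual \<open>P \<otimes> f\<close> for an object \<open>P\<close> is written \<open>\<one> P \<otimes> f\<close>.\<close>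

record ('o, 'm) monoidal_cat =
  Obj :: "'o set"
  Arr :: "'m set"
  Dom :: "'m \<Rightarrow> 'o"
  Cod :: "'m \<Rightarrow> 'o"
  Idt :: "'o \<Rightarrow> 'm" ("\<one>\<index>")
  Comp :: "'m \<Rightarrow> 'm \<Rightarrow> 'm" (infixr "\<cdot>\<index>" 65)
  TObj :: "'o \<Rightarrow> 'o \<Rightarrow> 'o" (infixr "\<odot>\<index>" 75)
  TArr :: "'m \<Rightarrow> 'm \<Rightarrow> 'm" (infixr "\<otimes>\<index>" 75)
  TUnit :: "'o" ("\<K>\<index>")
  Sym :: "'o \<Rightarrow> 'o \<Rightarrow> 'm" ("\<c>\<index>")

definition hom :: "('o, 'm, 'x) monoidal_cat_scheme \<Rightarrow> 'o \<Rightarrow> 'o \<Rightarrow> 'm set" ("hom\<index>") where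
  "hom\<^bsub>C\<^esub> A B = {f \<in> Arr C. Dom C f = A \<and> Cod C f = B}"

locale category =
  fixes C (structure)
  assumes Dom_Obj: "f \<in> Arr C \<Longrightarrow> Dom C f \<in> Obj C"
    and Cod_Obj: "f \<in> Arr C \<Longrightarrow> Cod C f \<in> Obj C"
    and Idt_hom: "A \<in> Obj C \<Longrightarrow> \<one> A \<in> hom A A"
    and Comp_hom: "\<lbrakk>f \<in> hom A B; g \<in> hom B D\<rbrakk> \<Longrightarrow> g \<cdot> f \<in> hom A D"
    and Comp_Idt: "f \<in> hom A B \<Longrightarrow> f \<cdot> \<one> A = f"
    and Idt_Comp: "f \<in> hom A B \<Longrightarrow> \<one> B \<cdot> f = f"
    and Comp_assoc:
      "\<lbrakk>f \<in> hom A B; g \<in> hom B D; h \<in> hom D E\<rbrakk> \<Longrightarrow> (h \<cdot> g) \<cdot> f = h \<cdot> (g \<cdot> f)"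

locale strict_monoidal_category = category +
  assumes TUnit_Obj: "\<K> \<in> Obj C"
    and TObj_Obj: "\<lbrakk>A \<in> Obj C; B \<in> Obj C\<rbrakk> \<Longrightarrow> A \<odot> B \<in> Obj C"
    and TObj_assoc:
      "\<lbrakk>A \<in> Obj C; B \<in> Obj C; D \<in> Obj C\<rbrakk> \<Longrightarrow> (A \<odot> B) \<odot> D = A \<odot> (B \<odot> D)"
    and TObj_TUnit_left: "A \<in> Obj C \<Longrightarrow> \<K> \<odot> A = A"
    and TObj_TUnit_right: "A \<in> Obj C \<Longrightarrow> A \<odot> \<K> = A"
    and TArr_hom: "\<lbrakk>f \<in> hom A B; g \<in> hom A' B'\<rbrakk> \<Longrightarrow> f \<otimes> g \<in> hom (A \<odot> A') (B \<odot> B')"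
    and TArr_Idt: "\<lbrakk>A \<in> Obj C; B \<in> Obj C\<rbrakk> \<Longrightarrow> \<one> A \<otimes> \<one> B = \<one> (A \<odot> B)"
    and interchange:
      "\<lbrakk>f \<in> hom A B; g \<in> hom B D; f' \<in> hom A' B'; g' \<in> hom B' D'\<rbrakk>
        \<Longrightarrow> (g \<cdot> f) \<otimes> (g' \<cdot> f') = (g \<otimes> g') \<cdot> (f \<otimes> f')"
    and TArr_assoc:
      "\<lbrakk>f \<in> Arr C; g \<in> Arr C; h \<in> Arr C\<rbrakk> \<Longrightarrow> (f \<otimes> g) \<otimes> h = f \<otimes> (g \<otimes> h)"
    and TArr_TUnit_left: "f \<in> Arr C \<Longrightarrow> \<one> \<K> \<otimes> f = f"
    and TArr_TUnit_right: "f \<in> Arr C \<Longrightarrow> f \<otimes> \<one> \<K> = f"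

locale strict_symmetric_monoidal_category = strict_monoidal_category +
  assumes Sym_hom: "\<lbrakk>A \<in> Obj C; B \<in> Obj C\<rbrakk> \<Longrightarrow> \<c> A B \<in> hom (A \<odot> B) (B \<odot> A)"
    and Sym_natural:
      "\<lbrakk>f \<in> hom A B; g \<in> hom A' B'\<rbrakk> \<Longrightarrow> \<c> B B' \<cdot> (f \<otimes> g) = (g \<otimes> f) \<cdot> \<c> A A'"
    and Sym_Sym: "\<lbrakk>A \<in> Obj C; B \<in> Obj C\<rbrakk> \<Longrightarrow> \<c> B A \<cdot> \<c> A B = \<one> (A \<odot> B)"
    and Sym_hexagon:
      "\<lbrakk>A \<in> Obj C; B \<in> Obj C; D \<in> Obj C\<rbrakk>
        \<Longrightarrow> \<c> A (B \<odot> D) = (\<one> B \<otimes> \<c> A D) \<cdot> (\<c> A B \<otimes> \<one> D)"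

definition inverse_arrows :: "('o, 'm, 'x) monoidal_cat_scheme \<Rightarrow> 'm \<Rightarrow> 'm \<Rightarrow> bool" where
  "inverse_arrows C f g \<longleftrightarrow> f \<in> Arr C \<and> g \<in> hom\<^bsub>C\<^esub> (Cod C f) (Dom C f)
     \<and> g \<cdot>\<^bsub>C\<^esub> f = \<one>\<^bsub>C\<^esub> (Dom C f) \<and> f \<cdot>\<^bsub>C\<^esub> g = \<one>\<^bsub>C\<^esub> (Cod C f)"

definition iso :: "('o, 'm, 'x) monoidal_cat_scheme \<Rightarrow> 'm \<Rightarrow> bool" where
  "iso C f \<longleftrightarrow> (\<exists>g. inverse_arrows C f g)"

text \<open>Meaningful only for isomorphisms, whose inverse is unique in any category.\<close>

definition inv_arr :: "('o, 'm, 'x) monoidal_cat_scheme \<Rightarrow> 'm \<Rightarrow> 'm" where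
  "inv_arr C f = (THE g. inverse_arrows C f g)"

locale monoid_object = strict_monoidal_category +
  fixes H \<eta> \<mu>
  assumes H_Obj: "H \<in> Obj C"
    and unit_hom: "\<eta> \<in> hom \<K> H"
    and mult_hom: "\<mu> \<in> hom (H \<odot> H) H"
    and unit_left: "\<mu> \<cdot> (\<eta> \<otimes> \<one> H) = \<one> H"
    and unit_right: "\<mu> \<cdot> (\<one> H \<otimes> \<eta>) = \<one> H"
    and mult_assoc: "\<mu> \<cdot> (\<mu> \<otimes> \<one> H) = \<mu> \<cdot> (\<one> H \<otimes> \<mu>)"

locale counital_comagma = strict_monoidal_category +
  fixes D \<epsilon> \<delta>
  assumes D_Obj: "D \<in> Obj C"
    and counit_hom: "\<epsilon> \<in> hom D \<K>"
    and comult_hom: "\<delta> \<in> hom D (D \<odot> D)"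
    and counit_left: "(\<epsilon> \<otimes> \<one> D) \<cdot> \<delta> = \<one> D"
    and counit_right: "(\<one> D \<otimes> \<epsilon>) \<cdot> \<delta> = \<one> D"

locale non_coassociative_bimonoid =
  strict_symmetric_monoidal_category C + monoid_object C H \<eta> \<mu> + counital_comagma C H \<epsilon> \<delta>
  for C (structure) and H \<eta> \<mu> \<epsilon> \<delta> +
  assumes counit_unit: "\<epsilon> \<cdot> \<eta> = \<one> \<K>"
    and comult_unit: "\<delta> \<cdot> \<eta> = \<eta> \<otimes> \<eta>"
    and counit_mult: "\<epsilon> \<cdot> \<mu> = \<epsilon> \<otimes> \<epsilon>"
    and comult_mult: "\<delta> \<cdot> \<mu> = (\<mu> \<otimes> \<mu>) \<cdot> (\<one> H \<otimes> \<c> H H \<otimes> \<one> H) \<cdot> (\<delta> \<otimes> \<delta>)"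

definition gamma_R :: "('o, 'm, 'x) monoidal_cat_scheme \<Rightarrow> 'o \<Rightarrow> 'm \<Rightarrow> 'm \<Rightarrow> 'm" where
  "gamma_R C H \<mu> \<delta> = (\<one>\<^bsub>C\<^esub> H \<otimes>\<^bsub>C\<^esub> \<mu>) \<cdot>\<^bsub>C\<^esub> (\<delta> \<otimes>\<^bsub>C\<^esub> \<one>\<^bsub>C\<^esub> H)"

definition gamma_L :: "('o, 'm, 'x) monoidal_cat_scheme \<Rightarrow> 'o \<Rightarrow> 'm \<Rightarrow> 'm \<Rightarrow> 'm" where
  "gamma_L C H \<mu> \<delta> = (\<mu> \<otimes>\<^bsub>C\<^esub> \<one>\<^bsub>C\<^esub> H) \<cdot>\<^bsub>C\<^esub> (\<one>\<^bsub>C\<^esub> H \<otimes>\<^bsub>C\<^esub> \<delta>)"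

definition right_codivision ::
  "('o, 'm, 'x) monoidal_cat_scheme \<Rightarrow> 'o \<Rightarrow> 'm \<Rightarrow> 'm \<Rightarrow> 'm \<Rightarrow> 'm \<Rightarrow> bool" where
  "right_codivision C H \<eta> \<mu> \<delta> r \<longleftrightarrow> r \<in> hom\<^bsub>C\<^esub> H (H \<odot>\<^bsub>C\<^esub> H)
     \<and> gamma_R C H \<mu> \<delta> \<cdot>\<^bsub>C\<^esub> r = \<one>\<^bsub>C\<^esub> H \<otimes>\<^bsub>C\<^esub> \<eta>
     \<and> (\<one>\<^bsub>C\<^esub> H \<otimes>\<^bsub>C\<^esub> \<mu>) \<cdot>\<^bsub>C\<^esub> (r \<otimes>\<^bsub>C\<^esub> \<one>\<^bsub>C\<^esub> H) \<cdot>\<^bsub>C\<^esub> \<delta> = \<one>\<^bsub>C\<^esub> H \<otimes>\<^bsub>C\<^esub> \<eta>"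

definition left_codivision ::
  "('o, 'm, 'x) monoidal_cat_scheme \<Rightarrow> 'o \<Rightarrow> 'm \<Rightarrow> 'm \<Rightarrow> 'm \<Rightarrow> 'm \<Rightarrow> bool" where
  "left_codivision C H \<eta> \<mu> \<delta> l \<longleftrightarrow> l \<in> hom\<^bsub>C\<^esub> H (H \<odot>\<^bsub>C\<^esub> H)
     \<and> gamma_L C H \<mu> \<delta> \<cdot>\<^bsub>C\<^esub> l = \<eta> \<otimes>\<^bsub>C\<^esub> \<one>\<^bsub>C\<^esub> H
     \<and> (\<mu> \<otimes>\<^bsub>C\<^esub> \<one>\<^bsub>C\<^esub> H) \<cdot>\<^bsub>C\<^esub> (\<one>\<^bsub>C\<^esub> H \<otimes>\<^bsub>C\<^esub> l) \<cdot>\<^bsub>C\<^esub> \<delta> = \<eta> \<otimes>\<^bsub>C\<^esub> \<one>\<^bsub>C\<^esub> H"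

end

theory Submission
  imports Defs
begin

text \<open>The monoid \<open>H\<close> makes \<open>- \<otimes> H\<close> a monad, with unit \<open>A \<otimes> \<eta>\<close> and with the Kleisli extension
  of \<open>f : A \<rightarrow> A \<otimes> H\<close> given by \<open>(A \<otimes> \<mu>) \<circ> (f \<otimes> H)\<close>, which is the unique right \<open>H\<close>-linear
  endomorphism of the free module \<open>A \<otimes> H\<close> that restricts to \<open>f\<close>. Now \<open>\<gamma>\<^sub>R\<close> is precisely the
  extension of \<open>\<delta>\<close>, and the two equations for a right codivision say precisely that \<open>r\<close> is a
  two-sided inverse of \<open>\<delta>\<close> in the Kleisli category. So assertion (i) is an instance of the fact
  that an arrow is invertible in the Kleisli category iff its extension is invertible in the base
  category: extension is a functor, so it preserves inverses; conversely, an inverse \<open>g\<close> of the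
  extension of \<open>d\<close> is the extension of its own restriction \<open>g \<circ> (A \<otimes> \<eta>)\<close>, since the latter
  extension is also a right inverse. Assertion (ii) is the same for the monad
  \<open>H \<otimes> -\<close>.

  Only Kleisli endomorphisms of a single object occur. The locale \<open>kleisli_monoid\<close> therefore
  axiomatises extension on one hom-set, \<open>iso_ext_iff\<close> and \<open>kleisli_inverse_eq\<close> prove the
  abstract fact there, and \<open>right_kleisli_monoid\<close> and \<open>left_kleisli_monoid\<close> supply the two
  instances.\<close>

section \<open>Inverse arrows\<close>

context category
begin

lemma hom_Arr: "f \<in> hom A B \<Longrightarrow> f \<in> Arr C"
  and hom_Dom: "f \<in> hom A B \<Longrightarrow> Dom C f = A"
  and hom_Cod: "f \<in> hom A B \<Longrightarrow> Cod C f = B"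
  by (simp_all add: hom_def)

lemma hom_Obj: "f \<in> hom A B \<Longrightarrow> A \<in> Obj C \<and> B \<in> Obj C"
  using Dom_Obj Cod_Obj by (auto simp: hom_def)

lemma inverse_arrows_hom_iff:
  assumes "f \<in> hom A B"
  shows "inverse_arrows C f g \<longleftrightarrow> g \<in> hom B A \<and> g \<cdot> f = \<one> A \<and> f \<cdot> g = \<one> B"
  using assms by (simp add: inverse_arrows_def hom_Arr hom_Dom hom_Cod)

lemma left_inverse_eq_right_inverse:
  assumes f: "f \<in> hom A B" and g: "g \<in> hom B A" "g \<cdot> f = \<one> A"
    and h: "h \<in> hom B A" "f \<cdot> h = \<one> B"
  shows "g = h"
proof -
  have "g = g \<cdot> (f \<cdot> h)" using Comp_Idt[OF g(1)] h(2) by simp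
  also have "\<dots> = (g \<cdot> f) \<cdot> h" using Comp_assoc[OF h(1) f g(1)] by simp
  also have "\<dots> = h" using Idt_Comp[OF h(1)] g(2) by simp
  finally show ?thesis .
qed

lemma inv_arr_eqI:
  assumes "f \<in> hom A B" "inverse_arrows C f g"
  shows "inv_arr C f = g"
  unfolding inv_arr_def
proof (rule the_equality)
  show "inverse_arrows C f g" by (rule assms(2))
  show "h = g" if "inverse_arrows C f h" for h
    using left_inverse_eq_right_inverse[OF assms(1)] assms(2) that
      inverse_arrows_hom_iff[OF assms(1)] by blast
qed

end

section \<open>Kleisli inverses of an endomorphism\<close>

text \<open>The hom-set of a Kleisli category from \<open>A\<close> to itself, where \<open>F\<close> is the value of the monad
  at \<open>A\<close>. The Kleisli composite of \<open>g\<close> followed by \<open>f\<close> is \<open>ext f \<cdot> g\<close>, and the Kleisli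
  identity is \<open>u\<close>.\<close>

locale kleisli_monoid = category +
  fixes A F u ext
  assumes u_hom: "u \<in> hom A F"
    and ext_hom: "f \<in> hom A F \<Longrightarrow> ext f \<in> hom F F"
    and ext_unit: "f \<in> hom A F \<Longrightarrow> ext f \<cdot> u = f"
    and unit_ext: "ext u = \<one> F"
    and ext_Comp: "\<lbrakk>f \<in> hom A F; g \<in> hom A F\<rbrakk> \<Longrightarrow> ext (ext f \<cdot> g) = ext f \<cdot> ext g"
begin

definition kleisli_inverse where
  "kleisli_inverse d r \<longleftrightarrow> r \<in> hom A F \<and> ext d \<cdot> r = u \<and> ext r \<cdot> d = u"

lemma inverse_arrows_ext:
  assumes d: "d \<in> hom A F" and r: "kleisli_inverse d r"
  shows "inverse_arrows C (ext d) (ext r)"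
proof -
  have rh: "r \<in> hom A F" using r by (simp add: kleisli_inverse_def)
  have "ext d \<cdot> ext r = \<one> F"
    using ext_Comp[OF d rh] r by (simp add: kleisli_inverse_def unit_ext)
  moreover have "ext r \<cdot> ext d = \<one> F"
    using ext_Comp[OF rh d] r by (simp add: kleisli_inverse_def unit_ext)
  ultimately show ?thesis
    using inverse_arrows_hom_iff[OF ext_hom[OF d]] ext_hom[OF rh] by simp
qed

text \<open>That \<open>r = g \<cdot> u\<close> is right inverse to \<open>d\<close> is immediate. It makes \<open>ext r\<close> a right inverse
  of \<open>ext d\<close>, hence equal to \<open>g\<close>; so \<open>g\<close> is an extension, and this gives the other equation.\<close>

lemma kleisli_inverse_of_inverse_arrows:
  assumes d: "d \<in> hom A F" and inv: "inverse_arrows C (ext d) g"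
  shows "kleisli_inverse d (g \<cdot> u)"
proof -
  note D = ext_hom[OF d]
  have g: "g \<in> hom F F" "g \<cdot> ext d = \<one> F" "ext d \<cdot> g = \<one> F"
    using inv inverse_arrows_hom_iff[OF D] by auto
  have r: "g \<cdot> u \<in> hom A F" by (rule Comp_hom[OF u_hom g(1)])
  have right: "ext d \<cdot> (g \<cdot> u) = u"
    using Comp_assoc[OF u_hom g(1) D] g(3) Idt_Comp[OF u_hom] by simp
  have "ext d \<cdot> ext (g \<cdot> u) = \<one> F"
    using ext_Comp[OF d r] right unit_ext by simp
  then have "g = ext (g \<cdot> u)"
    by (rule left_inverse_eq_right_inverse[OF D g(1,2) ext_hom[OF r]])
  then have "ext (g \<cdot> u) \<cdot> d = g \<cdot> (ext d \<cdot> u)"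
    using ext_unit[OF d] by simp
  also have "\<dots> = u"
    using Comp_assoc[OF u_hom D g(1)] g(2) Idt_Comp[OF u_hom] by simp
  finally show ?thesis using r right by (simp add: kleisli_inverse_def)
qed

lemma iso_ext_iff:
  assumes "d \<in> hom A F"
  shows "(\<exists>r. kleisli_inverse d r) \<longleftrightarrow> iso C (ext d)"
  unfolding iso_def
  using inverse_arrows_ext[OF assms] kleisli_inverse_of_inverse_arrows[OF assms] by blast

lemma kleisli_inverse_eq:
  assumes d: "d \<in> hom A F" and r: "kleisli_inverse d r"
  shows "r = inv_arr C (ext d) \<cdot> u"
proof -
  have "inv_arr C (ext d) = ext r"
    by (rule inv_arr_eqI[OF ext_hom[OF d] inverse_arrows_ext[OF d r]])
  then show ?thesis using r ext_unit[of r] by (simp add: kleisli_inverse_def)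
qed

end

section \<open>The free module monads of a monoid\<close>

context strict_monoidal_category
begin

lemma whisker_left_Comp:
  assumes "A \<in> Obj C" "f \<in> hom B D" "g \<in> hom D E"
  shows "\<one> A \<otimes> (g \<cdot> f) = (\<one> A \<otimes> g) \<cdot> (\<one> A \<otimes> f)"
  using interchange[OF Idt_hom Idt_hom assms(2,3)] Comp_Idt[OF Idt_hom] assms(1) by simp

lemma whisker_right_Comp:
  assumes "A \<in> Obj C" "f \<in> hom B D" "g \<in> hom D E"
  shows "(g \<cdot> f) \<otimes> \<one> A = (g \<otimes> \<one> A) \<cdot> (f \<otimes> \<one> A)"
  using interchange[OF assms(2,3) Idt_hom Idt_hom] Comp_Idt[OF Idt_hom] assms(1) by simp

lemma slide:
  assumes f: "f \<in> hom A B" and g: "g \<in> hom A' B'"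
  shows "(f \<otimes> \<one> B') \<cdot> (\<one> A \<otimes> g) = (\<one> B \<otimes> g) \<cdot> (f \<otimes> \<one> A')"
proof -
  have obj: "A \<in> Obj C" "B \<in> Obj C" "A' \<in> Obj C" "B' \<in> Obj C"
    using hom_Obj[OF f] hom_Obj[OF g] by auto
  show ?thesis
    using interchange[OF Idt_hom f g Idt_hom] interchange[OF f Idt_hom Idt_hom g] obj
      Comp_Idt[OF f] Idt_Comp[OF f] Comp_Idt[OF g] Idt_Comp[OF g] by simp
qed

end

context monoid_object
begin

lemma HH_Obj: "H \<odot> H \<in> Obj C"
  by (rule TObj_Obj[OF H_Obj H_Obj])

lemma right_kleisli_monoid:
  assumes A: "A \<in> Obj C"
  shows "kleisli_monoid C A (A \<odot> H) (\<one> A \<otimes> \<eta>) (\<lambda>f. (\<one> A \<otimes> \<mu>) \<cdot> (f \<otimes> \<one> H))"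
proof unfold_locales
  note idA = Idt_hom[OF A] and idH = Idt_hom[OF H_Obj]
  have AH: "A \<odot> H \<in> Obj C" by (rule TObj_Obj[OF A H_Obj])
  have mult: "\<one> A \<otimes> \<mu> \<in> hom ((A \<odot> H) \<odot> H) (A \<odot> H)"
    using TArr_hom[OF idA mult_hom] by (simp add: TObj_assoc A H_Obj)
  have unit: "\<one> A \<otimes> \<eta> \<in> hom A (A \<odot> H)"
    using TArr_hom[OF idA unit_hom] by (simp add: TObj_TUnit_right A)
  have fH: "f \<otimes> \<one> H \<in> hom (A \<odot> H) ((A \<odot> H) \<odot> H)" if "f \<in> hom A (A \<odot> H)" for f
    by (rule TArr_hom[OF that idH])
  have ext: "(\<one> A \<otimes> \<mu>) \<cdot> (f \<otimes> \<one> H) \<in> hom (A \<odot> H) (A \<odot> H)" if "f \<in> hom A (A \<odot> H)" for f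
    by (rule Comp_hom[OF fH[OF that] mult])
  show "\<one> A \<otimes> \<eta> \<in> hom A (A \<odot> H)" by (rule unit)
  show "(\<one> A \<otimes> \<mu>) \<cdot> (f \<otimes> \<one> H) \<in> hom (A \<odot> H) (A \<odot> H)" if "f \<in> hom A (A \<odot> H)" for f
    by (rule ext[OF that])
  show "(\<one> A \<otimes> \<mu>) \<cdot> ((\<one> A \<otimes> \<eta>) \<otimes> \<one> H) = \<one> (A \<odot> H)"
  proof -
    have \<eta>H: "\<eta> \<otimes> \<one> H \<in> hom H (H \<odot> H)"
      using TArr_hom[OF unit_hom idH] by (simp add: TObj_TUnit_left H_Obj)
    have "(\<one> A \<otimes> \<mu>) \<cdot> ((\<one> A \<otimes> \<eta>) \<otimes> \<one> H) = \<one> A \<otimes> (\<mu> \<cdot> (\<eta> \<otimes> \<one> H))"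
      using whisker_left_Comp[OF A \<eta>H mult_hom] TArr_assoc[of "\<one> A" \<eta> "\<one> H"]
        hom_Arr[OF idA] hom_Arr[OF idH] hom_Arr[OF unit_hom] by simp
    then show ?thesis by (simp add: unit_left TArr_Idt A H_Obj)
  qed
  show "((\<one> A \<otimes> \<mu>) \<cdot> (f \<otimes> \<one> H)) \<cdot> (\<one> A \<otimes> \<eta>) = f" if f: "f \<in> hom A (A \<odot> H)" for f
  proof -
    have H\<eta>: "\<one> H \<otimes> \<eta> \<in> hom H (H \<odot> H)"
      using TArr_hom[OF idH unit_hom] by (simp add: TObj_TUnit_right H_Obj)
    have AH\<eta>: "\<one> (A \<odot> H) \<otimes> \<eta> = \<one> A \<otimes> (\<one> H \<otimes> \<eta>)"
      using TArr_assoc[of "\<one> A" "\<one> H" \<eta>] hom_Arr[OF idA] hom_Arr[OF idH] hom_Arr[OF unit_hom]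
      by (simp add: TArr_Idt A H_Obj)
    have AH\<eta>_hom: "\<one> (A \<odot> H) \<otimes> \<eta> \<in> hom (A \<odot> H) ((A \<odot> H) \<odot> H)"
      using TArr_hom[OF Idt_hom[OF AH] unit_hom] by (simp add: TObj_TUnit_right AH)
    have "((\<one> A \<otimes> \<mu>) \<cdot> (f \<otimes> \<one> H)) \<cdot> (\<one> A \<otimes> \<eta>) = (\<one> A \<otimes> \<mu>) \<cdot> ((f \<otimes> \<one> H) \<cdot> (\<one> A \<otimes> \<eta>))"
      by (rule Comp_assoc[OF unit fH[OF f] mult])
    also have "\<dots> = (\<one> A \<otimes> \<mu>) \<cdot> ((\<one> (A \<odot> H) \<otimes> \<eta>) \<cdot> f)"
      using slide[OF f unit_hom] by (simp add: TArr_TUnit_right hom_Arr[OF f])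
    also have "\<dots> = ((\<one> A \<otimes> \<mu>) \<cdot> (\<one> (A \<odot> H) \<otimes> \<eta>)) \<cdot> f"
      by (rule Comp_assoc[OF f AH\<eta>_hom mult, symmetric])
    also have "\<dots> = (\<one> A \<otimes> (\<mu> \<cdot> (\<one> H \<otimes> \<eta>))) \<cdot> f"
      by (simp add: AH\<eta> whisker_left_Comp[OF A H\<eta> mult_hom])
    also have "\<dots> = f" by (simp add: unit_right TArr_Idt A H_Obj Idt_Comp[OF f])
    finally show ?thesis .
  qed
  show "(\<one> A \<otimes> \<mu>) \<cdot> ((((\<one> A \<otimes> \<mu>) \<cdot> (f \<otimes> \<one> H)) \<cdot> g) \<otimes> \<one> H)
      = ((\<one> A \<otimes> \<mu>) \<cdot> (f \<otimes> \<one> H)) \<cdot> ((\<one> A \<otimes> \<mu>) \<cdot> (g \<otimes> \<one> H))"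
    if f: "f \<in> hom A (A \<odot> H)" and g: "g \<in> hom A (A \<odot> H)" for f g
  proof -
    let ?f = "(\<one> A \<otimes> \<mu>) \<cdot> (f \<otimes> \<one> H)"
    note F = ext[OF f]
    \<comment> \<open>Associativity of \<open>\<mu>\<close> enters here, as linearity of the extension of \<open>f\<close>.\<close>
    have linear: "?f \<cdot> (\<one> A \<otimes> \<mu>) = (\<one> A \<otimes> \<mu>) \<cdot> (?f \<otimes> \<one> H)"
    proof -
      have H\<mu>: "\<one> H \<otimes> \<mu> \<in> hom (H \<odot> H \<odot> H) (H \<odot> H)" by (rule TArr_hom[OF idH mult_hom])
      have \<mu>H: "\<mu> \<otimes> \<one> H \<in> hom (H \<odot> H \<odot> H) (H \<odot> H)"
        using TArr_hom[OF mult_hom idH] by (simp add: TObj_assoc H_Obj)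
      have fHH: "f \<otimes> \<one> (H \<odot> H) \<in> hom ((A \<odot> H) \<odot> H) ((A \<odot> H) \<odot> (H \<odot> H))"
        using TArr_hom[OF f Idt_hom[OF HH_Obj]] by (simp add: TObj_assoc A H_Obj)
      have AH\<mu>_hom: "\<one> (A \<odot> H) \<otimes> \<mu> \<in> hom ((A \<odot> H) \<odot> (H \<odot> H)) ((A \<odot> H) \<odot> H)"
        by (rule TArr_hom[OF Idt_hom[OF AH] mult_hom])
      have A\<mu>H_hom: "(\<one> A \<otimes> \<mu>) \<otimes> \<one> H \<in> hom ((A \<odot> H) \<odot> (H \<odot> H)) ((A \<odot> H) \<odot> H)"
        using TArr_hom[OF mult idH] by (simp add: TObj_assoc TObj_Obj A H_Obj)
      have AH\<mu>: "\<one> (A \<odot> H) \<otimes> \<mu> = \<one> A \<otimes> (\<one> H \<otimes> \<mu>)"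
        using TArr_assoc[of "\<one> A" "\<one> H" \<mu>] hom_Arr[OF idA] hom_Arr[OF idH] hom_Arr[OF mult_hom]
        by (simp add: TArr_Idt A H_Obj)
      have A\<mu>H: "(\<one> A \<otimes> \<mu>) \<otimes> \<one> H = \<one> A \<otimes> (\<mu> \<otimes> \<one> H)"
        using TArr_assoc hom_Arr[OF idA] hom_Arr[OF idH] hom_Arr[OF mult_hom] by simp
      have fHH_eq: "f \<otimes> \<one> (H \<odot> H) = (f \<otimes> \<one> H) \<otimes> \<one> H"
        using TArr_assoc[of f "\<one> H" "\<one> H"] hom_Arr[OF f] hom_Arr[OF idH]
        by (simp add: TArr_Idt H_Obj)
      have mult': "\<one> A \<otimes> \<mu> \<in> hom (A \<odot> (H \<odot> H)) (A \<odot> H)"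
        using mult by (simp add: TObj_assoc A H_Obj)
      have "?f \<cdot> (\<one> A \<otimes> \<mu>) = (\<one> A \<otimes> \<mu>) \<cdot> ((f \<otimes> \<one> H) \<cdot> (\<one> A \<otimes> \<mu>))"
        by (rule Comp_assoc[OF mult fH[OF f] mult])
      also have "\<dots> = (\<one> A \<otimes> \<mu>) \<cdot> ((\<one> (A \<odot> H) \<otimes> \<mu>) \<cdot> (f \<otimes> \<one> (H \<odot> H)))"
        using slide[OF f mult_hom] by simp
      also have "\<dots> = ((\<one> A \<otimes> \<mu>) \<cdot> (\<one> (A \<odot> H) \<otimes> \<mu>)) \<cdot> (f \<otimes> \<one> (H \<odot> H))"
        by (rule Comp_assoc[OF fHH AH\<mu>_hom mult, symmetric])
      also have "(\<one> A \<otimes> \<mu>) \<cdot> (\<one> (A \<odot> H) \<otimes> \<mu>) = (\<one> A \<otimes> \<mu>) \<cdot> ((\<one> A \<otimes> \<mu>) \<otimes> \<one> H)"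
        using whisker_left_Comp[OF A H\<mu> mult_hom] whisker_left_Comp[OF A \<mu>H mult_hom]
        by (simp add: AH\<mu> A\<mu>H mult_assoc)
      also have "((\<one> A \<otimes> \<mu>) \<cdot> ((\<one> A \<otimes> \<mu>) \<otimes> \<one> H)) \<cdot> (f \<otimes> \<one> (H \<odot> H))
          = (\<one> A \<otimes> \<mu>) \<cdot> (((\<one> A \<otimes> \<mu>) \<otimes> \<one> H) \<cdot> (f \<otimes> \<one> (H \<odot> H)))"
        by (rule Comp_assoc[OF fHH A\<mu>H_hom mult])
      also have "\<dots> = (\<one> A \<otimes> \<mu>) \<cdot> (?f \<otimes> \<one> H)"
        by (simp add: fHH_eq whisker_right_Comp[OF H_Obj fH[OF f] mult])
      finally show ?thesis .
    qed
    have "(\<one> A \<otimes> \<mu>) \<cdot> ((?f \<cdot> g) \<otimes> \<one> H) = (\<one> A \<otimes> \<mu>) \<cdot> ((?f \<otimes> \<one> H) \<cdot> (g \<otimes> \<one> H))"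
      by (simp add: whisker_right_Comp[OF H_Obj g F])
    also have "\<dots> = ((\<one> A \<otimes> \<mu>) \<cdot> (?f \<otimes> \<one> H)) \<cdot> (g \<otimes> \<one> H)"
      by (rule Comp_assoc[OF fH[OF g] TArr_hom[OF F idH] mult, symmetric])
    also have "\<dots> = ?f \<cdot> ((\<one> A \<otimes> \<mu>) \<cdot> (g \<otimes> \<one> H))"
      using linear Comp_assoc[OF fH[OF g] mult F] by simp
    finally show ?thesis .
  qed
qed

end

text \<open>Reversing the tensor factors turns \<open>H \<otimes> -\<close> into \<open>- \<otimes> H\<close>, so that the statement about
  free left modules follows from the one about free right modules. The symmetry is copied unchanged
  and hence has the wrong type; only the underlying monoidal category is meaningful.\<close>

definition tensor_reversed ::
  "('o, 'm, 'x) monoidal_cat_scheme \<Rightarrow> ('o, 'm, 'x) monoidal_cat_scheme" where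
  "tensor_reversed C = C\<lparr>TObj := \<lambda>A B. TObj C B A, TArr := \<lambda>f g. TArr C g f\<rparr>"

lemma tensor_reversed_sel [simp]:
  "Obj (tensor_reversed C) = Obj C" "Arr (tensor_reversed C) = Arr C"
  "Dom (tensor_reversed C) = Dom C" "Cod (tensor_reversed C) = Cod C"
  "Idt (tensor_reversed C) = Idt C" "Comp (tensor_reversed C) = Comp C"
  "TObj (tensor_reversed C) A B = TObj C B A" "TArr (tensor_reversed C) f g = TArr C g f"
  "TUnit (tensor_reversed C) = TUnit C" "hom\<^bsub>tensor_reversed C\<^esub> = hom\<^bsub>C\<^esub>"
  by (simp_all add: tensor_reversed_def hom_def fun_eq_iff)

lemma (in strict_monoidal_category) strict_monoidal_category_tensor_reversed:
  "strict_monoidal_category (tensor_reversed C)"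
  by unfold_locales
    (simp_all add: Dom_Obj Cod_Obj Idt_hom Comp_hom Comp_Idt Idt_Comp Comp_assoc TUnit_Obj TObj_Obj
      TObj_assoc TObj_TUnit_left TObj_TUnit_right TArr_hom TArr_Idt interchange TArr_assoc
      TArr_TUnit_left TArr_TUnit_right)

context monoid_object
begin

lemma monoid_object_tensor_reversed: "monoid_object (tensor_reversed C) H \<eta> \<mu>"
  by (intro monoid_object.intro strict_monoidal_category_tensor_reversed monoid_object_axioms.intro)
    (simp_all add: H_Obj unit_hom mult_hom unit_left unit_right mult_assoc)

lemma left_kleisli_monoid:
  assumes "A \<in> Obj C"
  shows "kleisli_monoid C A (H \<odot> A) (\<eta> \<otimes> \<one> A) (\<lambda>f. (\<mu> \<otimes> \<one> A) \<cdot> (\<one> H \<otimes> f))"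
  using monoid_object.right_kleisli_monoid[OF monoid_object_tensor_reversed, of A] assms
    category_axioms
  by (simp add: kleisli_monoid_def kleisli_monoid_axioms_def)

end

section \<open>Codivisions as Kleisli inverses of the comultiplication\<close>

context non_coassociative_bimonoid
begin

sublocale right: kleisli_monoid C H "H \<odot> H" "\<one> H \<otimes> \<eta>" "\<lambda>f. (\<one> H \<otimes> \<mu>) \<cdot> (f \<otimes> \<one> H)"
  by (rule right_kleisli_monoid[OF H_Obj])

sublocale left: kleisli_monoid C H "H \<odot> H" "\<eta> \<otimes> \<one> H" "\<lambda>f. (\<mu> \<otimes> \<one> H) \<cdot> (\<one> H \<otimes> f)"
  by (rule left_kleisli_monoid[OF H_Obj])

lemma right_codivision_iff_kleisli_inverse:
  "right_codivision C H \<eta> \<mu> \<delta> r \<longleftrightarrow> right.kleisli_inverse \<delta> r"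
proof -
  have "\<one> H \<otimes> \<mu> \<in> hom ((H \<odot> H) \<odot> H) (H \<odot> H)"
    using TArr_hom[OF Idt_hom mult_hom] H_Obj by (simp add: TObj_assoc)
  then have "(\<one> H \<otimes> \<mu>) \<cdot> (r \<otimes> \<one> H) \<cdot> \<delta> = ((\<one> H \<otimes> \<mu>) \<cdot> (r \<otimes> \<one> H)) \<cdot> \<delta>"
    if "r \<in> hom H (H \<odot> H)"
    using Comp_assoc[OF comult_hom TArr_hom[OF that Idt_hom[OF H_Obj]]] by simp
  then show ?thesis
    by (auto simp: right_codivision_def right.kleisli_inverse_def gamma_R_def)
qed

lemma left_codivision_iff_kleisli_inverse:
  "left_codivision C H \<eta> \<mu> \<delta> l \<longleftrightarrow> left.kleisli_inverse \<delta> l"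
proof -
  have "\<mu> \<otimes> \<one> H \<in> hom (H \<odot> (H \<odot> H)) (H \<odot> H)"
    using TArr_hom[OF mult_hom Idt_hom] H_Obj by (simp add: TObj_assoc)
  then have "(\<mu> \<otimes> \<one> H) \<cdot> (\<one> H \<otimes> l) \<cdot> \<delta> = ((\<mu> \<otimes> \<one> H) \<cdot> (\<one> H \<otimes> l)) \<cdot> \<delta>"
    if "l \<in> hom H (H \<odot> H)"
    using Comp_assoc[OF comult_hom TArr_hom[OF Idt_hom[OF H_Obj] that]] by simp
  then show ?thesis
    by (auto simp: left_codivision_def left.kleisli_inverse_def gamma_L_def)
qed

end

theorem theorem2p4:
  fixes C :: "('o, 'm) monoidal_cat" (structure)
    and H :: 'o and \<eta> \<mu> \<epsilon> \<delta> :: 'm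
  assumes "non_coassociative_bimonoid C H \<eta> \<mu> \<epsilon> \<delta>"
  shows "(((\<exists>r. right_codivision C H \<eta> \<mu> \<delta> r) \<longleftrightarrow> iso C (gamma_R C H \<mu> \<delta>))
      \<and> (\<forall>r. right_codivision C H \<eta> \<mu> \<delta> r \<longrightarrow>
               r = inv_arr C (gamma_R C H \<mu> \<delta>) \<cdot> (\<one> H \<otimes> \<eta>)))
    \<and> (((\<exists>l. left_codivision C H \<eta> \<mu> \<delta> l) \<longleftrightarrow> iso C (gamma_L C H \<mu> \<delta>))
      \<and> (\<forall>l. left_codivision C H \<eta> \<mu> \<delta> l \<longrightarrow>
               l = inv_arr C (gamma_L C H \<mu> \<delta>) \<cdot> (\<eta> \<otimes> \<one> H)))"
proof -
  interpret non_coassociative_bimonoid C H \<eta> \<mu> \<epsilon> \<delta> by (rule assms)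
  show ?thesis
    unfolding right_codivision_iff_kleisli_inverse left_codivision_iff_kleisli_inverse
      gamma_R_def gamma_L_def
    using right.iso_ext_iff[OF comult_hom] right.kleisli_inverse_eq[OF comult_hom]
      left.iso_ext_iff[OF comult_hom] left.kleisli_inverse_eq[OF comult_hom]
    by blast
qed

end
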